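(* Let $A$ be a commutative ring, $R=A[\xi_i]_{i\ge1}$, let $\lambda$ be an $\infty$-composition on an index set $\mathcal{I}$, let $e$ be a weighting on $\mathcal{I}$, and let $Z$ be a subset of $\mathbf{U}^{\mathcal{I}}$. If $e$ is $\lambda$-reduced and $Z$ is irreducible then $\mathfrak{P}(\lambda,e;Z)$ is an $\mathfrak{S}$-prime of $R$.
   Context: $[\infty]=\{1,2,\ldots\}$; $\mathfrak{S}=\bigcup_{n\ge1}\mathfrak{S}_n$ is the group of permutations of $[\infty]$ moving finitely many elements, acting on $R$ by $A$-algebra automorphisms permuting the $\xi_i$. An $\mathfrak{S}$-ideal is an $\mathfrak{S}$-stable ideal; an $\mathfrak{S}$-ideal $\mathfrak{p}\ne R$ is $\mathfrak{S}$-prime if $\mathfrak{a}\mathfrak{b}\subset\mathfrak{p}$ implies $\mathfrak{a}\subset\mathfrak{p}$ or $\mathfrak{b}\subset\mathfrak{p}$ for $\mathfrak{S}$-ideals $\mathfrak{a},\mathfrak{b}$. An $\infty$-composition on a finite index set $\mathcal{I}$ is a function $\lambda\colon\mathcal{I}\to\mathbf{Z}_{\ge1}\cup\{\infty\}$ taking the value $\infty$ at least once. A weighting on $\mathcal{I}$ is a function $e\colon\mathcal{I}\to\mathbf{Z}_{\ge1}$; it is $\lambda$-reduced if $e_\alpha=1$ whenever $\lambda_\alpha<\infty$. A partition of $[\infty]$ of type $\lambda$ is a family $\mathcal{U}=\{U_\alpha\}_{\alpha\in\mathcal{I}}$ of disjoint non-empty subsets covering $[\infty]$ with $\#U_\alpha=\lambda_\alpha$;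 $\pi\colon[\infty]\to\mathcal{I}$ is given by $i\in U_{\pi(i)}$. Let $\tilde{S}_{\mathcal{U},0}=A[t_\alpha]_{\alpha\in\mathcal{I}}[(t_\alpha-t_\beta)^{-1}]_{\alpha\ne\beta}$, $\mathbf{U}^{\mathcal{I}}=\operatorname{Spec}(\tilde{S}_{\mathcal{U},0})$, $\tilde{S}_{\mathcal{U}}=\tilde{S}_{\mathcal{U},0}[\epsilon_i]_{i\ge1}$. For a subset $Z\subset\mathbf{U}^{\mathcal{I}}$ (set of scheme-theoretic points) let $\mathfrak{I}_0(Z)\subset\tilde{S}_{\mathcal{U},0}$ be its radical ideal (intersection of the primes in $Z$), and let $\mathfrak{Q}_{\mathcal{U}}(\lambda,e;Z)$ be the ideal of $\tilde{S}_{\mathcal{U}}$ generated by $\mathfrak{I}_0(Z)$ and all $\epsilon_i^{e(\pi(i))}$, $i\ge1$. Let $\iota\colon R\to\tilde{S}_{\mathcal{U}}$ be the $A$-algebra map $\xi_i\mapsto t_{\pi(i)}+\epsilon_i$. Then $\mathfrak{P}(\lambda,e;Z)=\{f\in R:\iota(\sigma f)\in\mathfrak{Q}_{\mathcal{U}}(\lambda,e;Z)\text{ for all }\sigma\in\mathfrak{S}\}$, which is independent of the choice of $\mathcal{U}$ of type $\lambda$. *)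

theory Defs
  imports
    "HOL-Analysis.Abstract_Topology"
    "HOL-Algebra.Algebraic_Closure_Type"
    "HOL-Algebra.Ideal_Product"
    "HOL-Library.Poly_Mapping"
    "HOL-Library.Extended_Nat"
    "HOL-Combinatorics.Perm"
begin

section \<open>Polynomial rings\<close>

text \<open>
  The polynomial ring \<open>A[x_v]\<close>, with \<open>v\<close> ranging over a type that may be infinite, is the monoid
  algebra of the finitely supported exponent vectors. Its ring structure is the one given by
  \<open>Poly_Mapping\<close>.
\<close>

type_synonym ('v, 'a) mpoly = "('v \<Rightarrow>\<^sub>0 nat) \<Rightarrow>\<^sub>0 'a"

definition Const :: "'a::comm_ring_1 \<Rightarrow> ('v, 'a) mpoly" where
  "Const a = Poly_Mapping.single 0 a"

definition Var :: "'v \<Rightarrow> ('v, 'a::comm_ring_1) mpoly" where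
  "Var v = Poly_Mapping.single (Poly_Mapping.single v 1) 1"

text \<open>
  For a ring homomorphism \<open>\<phi> : A \<rightarrow> S\<close>, \<open>aeval \<phi> x\<close> is the ring homomorphism \<open>A[x_v] \<rightarrow> S\<close>
  that extends \<open>\<phi>\<close> and sends the variable \<open>v\<close> to \<open>x v\<close>.
\<close>

definition aeval :: "('a::comm_ring_1 \<Rightarrow> 's::comm_ring_1) \<Rightarrow> ('v \<Rightarrow> 's) \<Rightarrow> ('v, 'a) mpoly \<Rightarrow> 's" where
  "aeval \<phi> x f =
     (\<Sum>m\<in>Poly_Mapping.keys f.
        \<phi> (Poly_Mapping.lookup f m) * (\<Prod>v\<in>Poly_Mapping.keys m. x v ^ Poly_Mapping.lookup m v))"

lemma mpoly_induct [case_names zero monomial_plus]: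
  fixes f :: "('v, 'a::comm_ring_1) mpoly"
  assumes "P 0"
    and "\<And>m c g. P g \<Longrightarrow> P (Poly_Mapping.single m c + g)"
  shows "P f"
proof (induction f rule: update_induct)
  case const
  show ?case by (rule assms(1))
next
  case (update f a b)
  have "Poly_Mapping.update a b f = Poly_Mapping.single a b + f"
  proof (rule poly_mapping_eqI)
    fix k
    show "Poly_Mapping.lookup (Poly_Mapping.update a b f) k
        = Poly_Mapping.lookup (Poly_Mapping.single a b + f) k"
      using update(1) by (auto simp: lookup_update lookup_add lookup_single when_def in_keys_iff)
  qed
  then show ?case using assms(2) update by simp
qed

context
  fixes \<phi> :: "'a::comm_ring_1 \<Rightarrow> 's::comm_ring_1"
  assumes \<phi>_one: "\<phi> 1 = 1"
    and \<phi>_add: "\<And>a b. \<phi> (a + b) = \<phi> a + \<phi> b"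
    and \<phi>_mult: "\<And>a b. \<phi> (a * b) = \<phi> a * \<phi> b"
begin

lemma aeval_base_zero: "\<phi> 0 = 0"
  using \<phi>_add[of 0 0] by simp

lemma aeval_zero: "aeval \<phi> x 0 = 0"
  by (simp add: aeval_def)

lemma aeval_single:
  "aeval \<phi> x (Poly_Mapping.single m c)
     = \<phi> c * (\<Prod>v\<in>Poly_Mapping.keys m. x v ^ Poly_Mapping.lookup m v)"
  by (cases "c = 0") (simp_all add: aeval_def aeval_base_zero)

lemma aeval_Const: "aeval \<phi> x (Const a) = \<phi> a"
  by (simp add: Const_def aeval_single)

lemma aeval_Var: "aeval \<phi> x (Var v) = x v"
  by (simp add: Var_def aeval_single \<phi>_one)

lemma aeval_one: "aeval \<phi> x 1 = 1"
  using aeval_single[of x 0 1] by (simp add: \<phi>_one)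

lemma aeval_add: "aeval \<phi> x (f + g) = aeval \<phi> x f + aeval \<phi> x g"
  unfolding aeval_def
  by (rule setsum_keys_plus_distrib) (simp_all add: aeval_base_zero \<phi>_add algebra_simps)

lemma aeval_minus: "aeval \<phi> x (f - g) = aeval \<phi> x f - aeval \<phi> x g"
  using aeval_add[of x "f - g" g] by simp

lemma aeval_monomial_mult:
  fixes m n :: "'v \<Rightarrow>\<^sub>0 nat"
  shows "(\<Prod>v\<in>Poly_Mapping.keys (m + n). x v ^ Poly_Mapping.lookup (m + n) v) =
   (\<Prod>v\<in>Poly_Mapping.keys m. x v ^ Poly_Mapping.lookup m v) *
   (\<Prod>v\<in>Poly_Mapping.keys n. (x v :: 's) ^ Poly_Mapping.lookup n v)"
proof -
  let ?K = "Poly_Mapping.keys m \<union> Poly_Mapping.keys n"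
  have ext: "(\<Prod>v\<in>Poly_Mapping.keys k. x v ^ Poly_Mapping.lookup k v)
      = (\<Prod>v\<in>?K. x v ^ Poly_Mapping.lookup k v)"
    if "Poly_Mapping.keys k \<subseteq> ?K" for k
    using that by (intro prod.mono_neutral_left) (auto simp: in_keys_iff)
  have "Poly_Mapping.keys (m + n) \<subseteq> ?K" by (rule Poly_Mapping.keys_add)
  then show ?thesis
    unfolding ext[OF \<open>Poly_Mapping.keys (m + n) \<subseteq> ?K\<close>] ext[of m, OF Un_upper1]
      ext[of n, OF Un_upper2]
    by (simp add: lookup_add power_add prod.distrib)
qed

lemma aeval_mult: "aeval \<phi> x (f * g) = aeval \<phi> x f * aeval \<phi> x g"
proof (induction f rule: mpoly_induct)
  case zero
  show ?case by (simp add: aeval_zero)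
next
  case (monomial_plus m c f)
  have "aeval \<phi> x (Poly_Mapping.single m c * g) = aeval \<phi> x (Poly_Mapping.single m c) * aeval \<phi> x g"
  proof (induction g rule: mpoly_induct)
    case zero
    show ?case by (simp add: aeval_zero)
  next
    case (monomial_plus n d g)
    then show ?case
      by (simp add: distrib_left aeval_add mult_single aeval_single aeval_monomial_mult \<phi>_mult
          mult_ac)
  qed
  with monomial_plus show ?case by (simp add: distrib_right aeval_add)
qed

end


section \<open>The ring of functions on the configuration space\<close>

text \<open>The submonoid of \<open>A[t_\<alpha>]\<close> generated by the differences \<open>t_\<alpha> - t_\<beta>\<close>, \<open>\<alpha> \<noteq> \<beta>\<close>.\<close>

inductive_set denoms :: "('i, 'a::comm_ring_1) mpoly set" where
  one: "1 \<in> denoms"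
| mult: "s \<in> denoms \<Longrightarrow> \<alpha> \<noteq> \<beta> \<Longrightarrow> s * (Var \<alpha> - Var \<beta>) \<in> denoms"

lemma denoms_mult_closed:
  assumes "s \<in> denoms" "u \<in> denoms"
  shows "s * u \<in> denoms"
  using assms(2)
proof induction
  case one
  then show ?case using assms(1) by simp
next
  case (mult u \<alpha> \<beta>)
  then show ?case using denoms.mult[of "s * u" \<alpha> \<beta>] by (simp add: mult.assoc)
qed

text \<open>The base ring may have zero divisors, so equality of fractions needs the extra factor \<open>w\<close>.\<close>

definition config_rel ::
    "('i, 'a::comm_ring_1) mpoly \<times> ('i, 'a) mpoly \<Rightarrow> ('i, 'a) mpoly \<times> ('i, 'a) mpoly \<Rightarrow> bool" where
  "config_rel x y \<longleftrightarrow> snd x \<in> denoms \<and> snd y \<in> denoms \<and>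
     (\<exists>w\<in>denoms. w * (fst x * snd y) = w * (fst y * snd x))"

lemma part_equivp_config_rel: "part_equivp (config_rel :: ('i, 'a::comm_ring_1) mpoly \<times> _ \<Rightarrow> _)"
proof (rule part_equivpI)
  show "\<exists>x :: ('i, 'a) mpoly \<times> _. config_rel x x"
    by (rule exI[of _ "(0, 1)"]) (auto simp: config_rel_def intro: denoms.one)
  show "symp (config_rel :: ('i, 'a) mpoly \<times> _ \<Rightarrow> _)"
    unfolding symp_def config_rel_def by metis
  show "transp (config_rel :: ('i, 'a) mpoly \<times> _ \<Rightarrow> _)"
  proof (rule transpI, unfold split_paired_all)
    fix a s b t c u :: "('i, 'a) mpoly"
    assume A: "config_rel (a, s) (b, t)" and B: "config_rel (b, t) (c, u)"
    from A obtain v where v: "v \<in> denoms" "v * (a * t) = v * (b * s)"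
      by (auto simp: config_rel_def)
    from B obtain w where w: "w \<in> denoms" "w * (b * u) = w * (c * t)"
      by (auto simp: config_rel_def)
    have den: "s \<in> denoms" "t \<in> denoms" "u \<in> denoms"
      using A B by (auto simp: config_rel_def)
    have "(v * w * t) * (a * u) = (v * (a * t)) * (w * u)" by (simp add: mult_ac)
    also have "\<dots> = (w * (b * u)) * (v * s)" by (simp only: v) (simp add: mult_ac)
    also have "\<dots> = (v * w * t) * (c * s)" by (simp only: w) (simp add: mult_ac)
    finally have "(v * w * t) * (a * u) = (v * w * t) * (c * s)" .
    moreover have "v * w * t \<in> denoms" using v w den by (intro denoms_mult_closed)
    ultimately show "config_rel (a, s) (c, u)"
      using den by (auto simp: config_rel_def)
  qed
qed

text \<open>The localization \<open>A[t_\<alpha>][(t_\<alpha> - t_\<beta>)\<^sup>-\<^sup>1]\<close>, with \<open>\<alpha> \<noteq> \<beta>\<close> ranging over the index type \<open>'i\<close>.\<close>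

quotient_type (overloaded) ('i, 'a) config_ring =
  "('i::finite, 'a::comm_ring_1) mpoly \<times> ('i, 'a) mpoly" / partial: config_rel
  by (rule part_equivp_config_rel)

lifting_forget poly_mapping.lifting

lift_definition config_frac ::
    "('i::finite, 'a::comm_ring_1) mpoly \<Rightarrow> ('i, 'a) mpoly \<Rightarrow> ('i, 'a) config_ring"
  is "\<lambda>p s. if s \<in> denoms then (p, s) else (0, 1)"
  by (auto simp: config_rel_def intro: denoms.one)

lemma config_frac_cases [cases type: config_ring]:
  obtains (frac) p s where "q = config_frac p s" "s \<in> denoms"
  by transfer (auto simp: config_rel_def split: if_splits)

lemma config_frac_eq_iff:
  assumes "s \<in> denoms" "u \<in> denoms"
  shows "config_frac p s = config_frac q u \<longleftrightarrow> (\<exists>w\<in>denoms. w * (p * u) = w * (q * s))"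
  using assms by transfer (auto simp: config_rel_def)

text \<open>
  Over \<open>A[X]\<close>, sending the finitely many \<open>t_\<alpha>\<close> to distinct powers of \<open>X\<close> turns every denominator
  into a polynomial with leading coefficient \<open>1\<close> or \<open>-1\<close>.
\<close>

lemma denoms_nonzero: "0 \<notin> (denoms :: ('i::finite, 'a::comm_ring_1) mpoly set)"
proof
  assume zero: "(0 :: ('i, 'a) mpoly) \<in> denoms"
  obtain k :: "'i \<Rightarrow> nat" where k: "inj k"
    using finite_imp_inj_to_nat_seg[of "UNIV :: 'i set"] by auto
  define E :: "('i, 'a) mpoly \<Rightarrow> 'a poly"
    where "E = aeval (\<lambda>a. [:a:]) (\<lambda>\<alpha>. Polynomial.monom 1 (k \<alpha>))"
  have hom: "E 1 = 1" "E (f * g) = E f * E g" "E (f - g) = E f - E g" "E 0 = 0"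
    "E (Var \<alpha>) = Polynomial.monom 1 (k \<alpha>)" for f g \<alpha>
    by (simp_all add: E_def aeval_one aeval_mult aeval_minus aeval_zero aeval_Var)
  have lc_mult: "lead_coeff (p * q) \<in> {1, -1}"
    if "lead_coeff p \<in> {1, -1}" "lead_coeff q \<in> {1, -1}" for p q :: "'a poly"
  proof -
    have c: "coeff (p * q) (Polynomial.degree p + Polynomial.degree q) \<in> {1, -1}"
      using that by (auto simp: coeff_mult_degree_sum)
    then have "coeff (p * q) (Polynomial.degree p + Polynomial.degree q) \<noteq> 0" by auto
    then have "Polynomial.degree (p * q) = Polynomial.degree p + Polynomial.degree q"
      using degree_mult_le[of p q] le_degree[of "p * q"] by (simp add: order_antisym)
    with c show ?thesis by simp
  qed
  have lc_diff: "lead_coeff (Polynomial.monom 1 a - Polynomial.monom 1 b :: 'a poly) \<in> {1, -1}"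
    if "a \<noteq> b" for a b :: nat
  proof -
    have "Polynomial.degree (Polynomial.monom 1 a - Polynomial.monom 1 b :: 'a poly) = max a b"
    proof (rule order_antisym)
      show "Polynomial.degree (Polynomial.monom 1 a - Polynomial.monom 1 b :: 'a poly) \<le> max a b"
        by (rule degree_diff_le) (simp_all add: Polynomial.degree_monom_eq)
      show "max a b \<le> Polynomial.degree (Polynomial.monom 1 a - Polynomial.monom 1 b :: 'a poly)"
        using that by (intro le_degree) (auto simp: max_def)
    qed
    then show ?thesis using that by (auto simp: max_def)
  qed
  have "lead_coeff (E s) \<in> {1, -1}" if "s \<in> denoms" for s
    using that
  proof induction
    case one
    then show ?case by (simp add: hom)
  next
    case (mult s \<alpha> \<beta>)
    then have "k \<alpha> \<noteq> k \<beta>" using k by (auto dest: injD)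
    with mult show ?case
      using lc_mult[OF mult.IH lc_diff[of "k \<alpha>" "k \<beta>"]] by (simp add: hom)
  qed
  from this[OF zero] show False by (simp add: hom)
qed

instantiation config_ring :: (finite, comm_ring_1) comm_ring_1
begin

lift_definition zero_config_ring :: "('a, 'b) config_ring" is "(0, 1)"
  by (auto simp: config_rel_def intro: denoms.one)

lift_definition one_config_ring :: "('a, 'b) config_ring" is "(1, 1)"
  by (auto simp: config_rel_def intro: denoms.one)

lift_definition plus_config_ring ::
    "('a, 'b) config_ring \<Rightarrow> ('a, 'b) config_ring \<Rightarrow> ('a, 'b) config_ring"
  is "\<lambda>x y. (fst x * snd y + fst y * snd x, snd x * snd y)"
proof (unfold split_paired_all fst_conv snd_conv)
  fix a s a' s' b t b' t' :: "('a, 'b) mpoly"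
  assume A: "config_rel (a, s) (a', s')" and B: "config_rel (b, t) (b', t')"
  from A obtain v where v: "v \<in> denoms" "v * (a * s') = v * (a' * s)"
    by (auto simp: config_rel_def)
  from B obtain w where w: "w \<in> denoms" "w * (b * t') = w * (b' * t)"
    by (auto simp: config_rel_def)
  have "(v * w) * ((a * t + b * s) * (s' * t'))
      = (v * (a * s')) * (w * t * t') + (w * (b * t')) * (v * s * s')"
    by (simp add: algebra_simps)
  also have "\<dots> = (v * w) * ((a' * t' + b' * s') * (s * t))"
    by (simp only: v w) (simp add: algebra_simps)
  finally show "config_rel (a * t + b * s, s * t) (a' * t' + b' * s', s' * t')"
    using A B v w by (auto simp: config_rel_def intro!: denoms_mult_closed bexI[of _ "v * w"])
qed

lift_definition uminus_config_ring :: "('a, 'b) config_ring \<Rightarrow> ('a, 'b) config_ring"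
  is "\<lambda>x. (- fst x, snd x)"
  by (auto simp: config_rel_def)

definition minus_config_ring ::
    "('a, 'b) config_ring \<Rightarrow> ('a, 'b) config_ring \<Rightarrow> ('a, 'b) config_ring" where
  "minus_config_ring x y = x + - y"

lift_definition times_config_ring ::
    "('a, 'b) config_ring \<Rightarrow> ('a, 'b) config_ring \<Rightarrow> ('a, 'b) config_ring"
  is "\<lambda>x y. (fst x * fst y, snd x * snd y)"
proof (unfold split_paired_all fst_conv snd_conv)
  fix a s a' s' b t b' t' :: "('a, 'b) mpoly"
  assume A: "config_rel (a, s) (a', s')" and B: "config_rel (b, t) (b', t')"
  from A obtain v where v: "v \<in> denoms" "v * (a * s') = v * (a' * s)"
    by (auto simp: config_rel_def)
  from B obtain w where w: "w \<in> denoms" "w * (b * t') = w * (b' * t)"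
    by (auto simp: config_rel_def)
  have "(v * w) * ((a * b) * (s' * t')) = (v * (a * s')) * (w * (b * t'))"
    by (simp add: mult_ac)
  also have "\<dots> = (v * w) * ((a' * b') * (s * t))"
    by (simp only: v w) (simp add: mult_ac)
  finally show "config_rel (a * b, s * t) (a' * b', s' * t')"
    using A B v w by (auto simp: config_rel_def intro!: denoms_mult_closed bexI[of _ "v * w"])
qed

lemma config_frac_simps:
  assumes "s \<in> denoms" "u \<in> denoms"
  shows "config_frac p s + config_frac q u = config_frac (p * u + q * s) (s * u)"
    and "config_frac p s * config_frac q u = config_frac (p * q) (s * u)"
    and "- config_frac p s = config_frac (- p) s"
  using assms
  by (transfer; use denoms.one in \<open>auto simp: config_rel_def intro: denoms_mult_closed\<close>)+

lemma config_frac_zero_one: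
  "(0 :: ('a, 'b) config_ring) = config_frac 0 1" "(1 :: ('a, 'b) config_ring) = config_frac 1 1"
  by (transfer; use denoms.one in \<open>auto simp: config_rel_def\<close>)+

instance
proof
  have eqI: "config_frac p s = config_frac q u"
    if "s \<in> denoms" "u \<in> denoms" "p * u = q * s" for p q s u :: "('a, 'b) mpoly"
    using that denoms.one by (auto simp: config_frac_eq_iff)
  note [simp] = config_frac_simps denoms_mult_closed denoms.one
  fix x y z :: "('a, 'b) config_ring"
  show "x * y * z = x * (y * z)"
    by (cases x, cases y, cases z) (auto intro!: eqI simp: algebra_simps)
  show "x * y = y * x"
    by (cases x, cases y) (auto intro!: eqI simp: algebra_simps)
  show "1 * x = x"
    by (cases x) (auto simp: config_frac_zero_one)
  show "x + y + z = x + (y + z)"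
    by (cases x, cases y, cases z) (auto intro!: eqI simp: algebra_simps)
  show "x + y = y + x"
    by (cases x, cases y) (auto intro!: eqI simp: algebra_simps)
  show "0 + x = x"
    by (cases x) (auto simp: config_frac_zero_one)
  show "- x + x = 0"
    by (cases x) (auto intro!: eqI simp: config_frac_zero_one algebra_simps)
  show "x - y = x + - y"
    by (rule minus_config_ring_def)
  show "(x + y) * z = x * z + y * z"
    by (cases x, cases y, cases z) (auto intro!: eqI simp: algebra_simps)
  show "(0 :: ('a, 'b) config_ring) \<noteq> 1"
    using denoms_nonzero by (auto simp: config_frac_zero_one config_frac_eq_iff)
qed

end

definition config_const :: "'a::comm_ring_1 \<Rightarrow> ('i::finite, 'a) config_ring" where
  "config_const a = config_frac (Const a) 1"

definition config_coord :: "'i \<Rightarrow> ('i::finite, 'a::comm_ring_1) config_ring" where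
  "config_coord \<alpha> = config_frac (Var \<alpha>) 1"


section \<open>Spectra and irreducible sets\<close>

definition spec :: "'r::comm_ring_1 set set" where
  "spec = {\<pp>. primeideal \<pp> ring_of_type_algebra}"

definition zariski :: "'r::comm_ring_1 set topology" where
  "zariski = topology (\<lambda>W. W \<subseteq> spec \<and> (\<exists>E. spec - W = {\<pp> \<in> spec. E \<subseteq> \<pp>}))"

definition irreducible_space :: "'x topology \<Rightarrow> bool" where
  "irreducible_space T \<longleftrightarrow> topspace T \<noteq> {} \<and>
     (\<forall>C D. closedin T C \<longrightarrow> closedin T D \<longrightarrow>
        topspace T = C \<union> D \<longrightarrow> C = topspace T \<or> D = topspace T)"

lemma istopology_zariski:
  "istopology (\<lambda>W :: 'r::comm_ring_1 set set. W \<subseteq> spec \<and> (\<exists>E. spec - W = {\<pp> \<in> spec. E \<subseteq> \<pp>}))"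
  unfolding istopology_def
proof (intro conjI allI impI)
  fix S T :: "'r set set"
  assume "S \<subseteq> spec \<and> (\<exists>E. spec - S = {\<pp> \<in> spec. E \<subseteq> \<pp>})"
    and "T \<subseteq> spec \<and> (\<exists>E. spec - T = {\<pp> \<in> spec. E \<subseteq> \<pp>})"
  then obtain E F where E: "S \<subseteq> spec" "spec - S = {\<pp> \<in> spec. E \<subseteq> \<pp>}"
    and F: "T \<subseteq> spec" "spec - T = {\<pp> \<in> spec. F \<subseteq> \<pp>}" by auto
  show "S \<inter> T \<subseteq> spec" using E by auto
  let ?G = "{a * b | a b. a \<in> E \<and> b \<in> F}"
  have "?G \<subseteq> \<pp> \<longleftrightarrow> E \<subseteq> \<pp> \<or> F \<subseteq> \<pp>" if "\<pp> \<in> spec" for \<pp>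
  proof -
    have prime: "primeideal \<pp> (ring_of_type_algebra :: 'r ring)" using that by (simp add: spec_def)
    interpret primeideal \<pp> "ring_of_type_algebra :: 'r ring" by (rule prime)
    have l: "a * b \<in> \<pp>" "b * a \<in> \<pp>" if "a \<in> \<pp>" for a b
      using I_l_closed[OF that, of b] I_r_closed[OF that, of b]
      by (simp_all add: ring_of_type_algebra_def)
    have p: "a \<in> \<pp> \<or> b \<in> \<pp>" if "a * b \<in> \<pp>" for a b
      using I_prime[of a b] that by (simp add: ring_of_type_algebra_def)
    show ?thesis using l p by blast
  qed
  then have "{\<pp> \<in> spec. ?G \<subseteq> \<pp>} = {\<pp> \<in> spec. E \<subseteq> \<pp>} \<union> {\<pp> \<in> spec. F \<subseteq> \<pp>}"
    by blast
  then have "spec - S \<inter> T = {\<pp> \<in> spec. ?G \<subseteq> \<pp>}" unfolding Diff_Int E(2) F(2) by simp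
  then show "\<exists>E. spec - S \<inter> T = {\<pp> \<in> spec. E \<subseteq> \<pp>}" by blast
next
  fix \<K> :: "'r set set set"
  assume K: "\<forall>K\<in>\<K>. K \<subseteq> spec \<and> (\<exists>E. spec - K = {\<pp> \<in> spec. E \<subseteq> \<pp>})"
  then show "\<Union> \<K> \<subseteq> spec" by auto
  from K obtain E where E: "\<And>K. K \<in> \<K> \<Longrightarrow> spec - K = {\<pp> \<in> spec. E K \<subseteq> \<pp>}" by metis
  have "spec - \<Union>\<K> = {\<pp> \<in> spec. (\<Union>K\<in>\<K>. E K) \<subseteq> \<pp>}"
  proof (rule Set.set_eqI)
    fix \<pp>
    have "\<pp> \<notin> K \<longleftrightarrow> E K \<subseteq> \<pp>" if "\<pp> \<in> spec" "K \<in> \<K>" for K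
      using E[OF \<open>K \<in> \<K>\<close>] \<open>\<pp> \<in> spec\<close> by (metis (mono_tags, lifting) DiffE DiffI mem_Collect_eq)
    then show "\<pp> \<in> spec - \<Union>\<K> \<longleftrightarrow> \<pp> \<in> {\<pp> \<in> spec. (\<Union>K\<in>\<K>. E K) \<subseteq> \<pp>}"
      by (auto simp: UN_subset_iff)
  qed
  then show "\<exists>E. spec - \<Union>\<K> = {\<pp> \<in> spec. E \<subseteq> \<pp>}" by blast
qed

lemma openin_zariski:
  "openin zariski W \<longleftrightarrow> W \<subseteq> spec \<and> (\<exists>E. spec - W = {\<pp> \<in> spec. E \<subseteq> \<pp>})"
  unfolding zariski_def by (simp add: istopology_zariski)

lemma topspace_zariski: "topspace zariski = (spec :: 'r::comm_ring_1 set set)"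
proof -
  have "1 \<notin> \<pp>" if "\<pp> \<in> spec" for \<pp> :: "'r set"
  proof
    assume one: "1 \<in> \<pp>"
    have prime: "primeideal \<pp> (ring_of_type_algebra :: 'r ring)" using that by (simp add: spec_def)
    interpret primeideal \<pp> "ring_of_type_algebra :: 'r ring" by (rule prime)
    show False using one_imp_carrier I_notcarr one by (simp add: ring_of_type_algebra_def)
  qed
  then have "openin zariski (spec :: 'r set set)"
    by (auto simp: openin_zariski intro!: exI[of _ "{1}"])
  moreover have "topspace zariski \<subseteq> (spec :: 'r set set)"
    using openin_topspace[of zariski] unfolding openin_zariski by (rule conjunct1)
  ultimately show ?thesis
    using openin_subset by blast
qed

lemma closedin_zariski: "closedin zariski C \<longleftrightarrow> (\<exists>E. C = {\<pp> \<in> spec. E \<subseteq> \<pp>})"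
proof
  assume "closedin zariski C"
  then have "C \<subseteq> spec" "\<exists>E. spec - (spec - C) = {\<pp> \<in> spec. E \<subseteq> \<pp>}"
    by (simp_all add: closedin_def topspace_zariski openin_zariski)
  then show "\<exists>E. C = {\<pp> \<in> spec. E \<subseteq> \<pp>}" by (simp add: double_diff)
next
  assume "\<exists>E. C = {\<pp> \<in> spec. E \<subseteq> \<pp>}"
  then have *: "C \<subseteq> spec" "\<exists>E. C = {\<pp> \<in> spec. E \<subseteq> \<pp>}" by blast+
  then have "spec - (spec - C) = C" by (simp add: double_diff)
  with * show "closedin zariski C"
    by (simp add: closedin_def topspace_zariski openin_zariski)
qed


section \<open>\<open>\<SS>\<close>-ideals\<close>

text \<open>
  \<open>[\<infinity>]\<close> is indexed by \<open>nat\<close>, i.e. shifted to start at \<open>0\<close>, and \<open>\<SS>\<close> is the type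
  \<open>nat perm\<close> of permutations moving only finitely many points.
\<close>

definition perm_act :: "nat perm \<Rightarrow> (nat, 'a::comm_ring_1) mpoly \<Rightarrow> (nat, 'a) mpoly" where
  "perm_act \<sigma> = aeval Const (\<lambda>i. Var (Perm.apply \<sigma> i))"

definition sym_ideal :: "(nat, 'a::comm_ring_1) mpoly set \<Rightarrow> bool" where
  "sym_ideal \<aa> \<longleftrightarrow> ideal \<aa> ring_of_type_algebra \<and> (\<forall>\<sigma>. perm_act \<sigma> ` \<aa> \<subseteq> \<aa>)"

definition sym_prime :: "(nat, 'a::comm_ring_1) mpoly set \<Rightarrow> bool" where
  "sym_prime \<pp> \<longleftrightarrow> sym_ideal \<pp> \<and> \<pp> \<noteq> UNIV \<and>
     (\<forall>\<aa> \<bb>. sym_ideal \<aa> \<longrightarrow> sym_ideal \<bb> \<longrightarrow>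
        ideal_prod ring_of_type_algebra \<aa> \<bb> \<subseteq> \<pp> \<longrightarrow> \<aa> \<subseteq> \<pp> \<or> \<bb> \<subseteq> \<pp>)"


section \<open>The ideals \<open>\<PP>(\<lambda>, e; Z)\<close>\<close>

text \<open>The finite index set is the universe of a finite type \<open>'i\<close>.\<close>

definition infty_composition :: "('i::finite \<Rightarrow> enat) \<Rightarrow> bool" where
  "infty_composition lam \<longleftrightarrow> (\<forall>\<alpha>. 1 \<le> lam \<alpha>) \<and> (\<exists>\<alpha>. lam \<alpha> = \<infinity>)"

definition weighting :: "('i::finite \<Rightarrow> nat) \<Rightarrow> bool" where
  "weighting e \<longleftrightarrow> (\<forall>\<alpha>. 1 \<le> e \<alpha>)"

definition reduced_weighting :: "('i::finite \<Rightarrow> enat) \<Rightarrow> ('i \<Rightarrow> nat) \<Rightarrow> bool" where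
  "reduced_weighting lam e \<longleftrightarrow> (\<forall>\<alpha>. lam \<alpha> < \<infinity> \<longrightarrow> e \<alpha> = 1)"

definition set_size :: "'x set \<Rightarrow> enat" where
  "set_size S = (if finite S then enat (card S) else \<infinity>)"

definition partition_of_type :: "('i::finite \<Rightarrow> enat) \<Rightarrow> ('i \<Rightarrow> nat set) \<Rightarrow> bool" where
  "partition_of_type lam U \<longleftrightarrow>
     disjoint_family U \<and> (\<forall>\<alpha>. U \<alpha> \<noteq> {}) \<and> (\<Union>\<alpha>. U \<alpha>) = UNIV \<and> (\<forall>\<alpha>. set_size (U \<alpha>) = lam \<alpha>)"

definition part_of :: "('i::finite \<Rightarrow> nat set) \<Rightarrow> nat \<Rightarrow> 'i" where
  "part_of U i = (THE \<alpha>. i \<in> U \<alpha>)"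

text \<open>For \<open>Z = {}\<close> this is the unit ideal.\<close>

definition radical_ideal :: "'r::comm_ring_1 set set \<Rightarrow> 'r set" where
  "radical_ideal Z = \<Inter>Z"

text \<open>
  The variables of the outer polynomial ring are the \<open>\<epsilon>_i\<close>. The type \<open>\<lambda>\<close> is determined
  by the partition \<open>U\<close>, so it is not an argument of the ideals below.
\<close>

definition frakQ ::
    "('i \<Rightarrow> nat set) \<Rightarrow> ('i \<Rightarrow> nat) \<Rightarrow> ('i::finite, 'a::comm_ring_1) config_ring set set
       \<Rightarrow> (nat, ('i, 'a) config_ring) mpoly set" where
  "frakQ U e Z = genideal ring_of_type_algebra
     (Const ` radical_ideal Z \<union> {Var i ^ e (part_of U i) | i. True})"

definition iota ::
    "('i::finite \<Rightarrow> nat set) \<Rightarrow> (nat, 'a::comm_ring_1) mpoly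
       \<Rightarrow> (nat, ('i, 'a) config_ring) mpoly" where
  "iota U = aeval (\<lambda>a. Const (config_const a)) (\<lambda>i. Const (config_coord (part_of U i)) + Var i)"

definition frakP ::
    "('i \<Rightarrow> nat set) \<Rightarrow> ('i \<Rightarrow> nat) \<Rightarrow> ('i::finite, 'a::comm_ring_1) config_ring set set
       \<Rightarrow> (nat, 'a) mpoly set" where
  "frakP U e Z = {f. \<forall>\<sigma>. iota U (perm_act \<sigma> f) \<in> frakQ U e Z}"

text \<open>Every \<open>\<infinity>\<close>-composition is the type of some partition.\<close>

lemma partition_of_type_exists:
  fixes lam :: "'i::finite \<Rightarrow> enat"
  assumes "infty_composition lam"
  shows "\<exists>U. partition_of_type lam U"
proof -
  define T where "T = (SIGMA \<alpha>:UNIV. {k. enat k < lam \<alpha>})"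
  obtain \<omega> where \<omega>: "lam \<omega> = \<infinity>" using assms by (auto simp: infty_composition_def)
  have "range (Pair \<omega>) \<subseteq> T" by (auto simp: T_def \<omega>)
  moreover have "infinite (range (Pair \<omega>) :: ('i \<times> nat) set)"
    by (rule range_inj_infinite) (auto simp: inj_on_def)
  ultimately have "infinite T" by (meson finite_subset)
  moreover have "countable T" unfolding T_def by (intro countable_SIGMA) auto
  ultimately have h: "bij_betw (from_nat_into T) UNIV T" by (intro bij_betw_from_nat_into)
  define U where "U = (\<lambda>\<alpha>. {n. fst (from_nat_into T n) = \<alpha>})"
  have "set_size (U \<alpha>) = lam \<alpha>" for \<alpha>
  proof -
    have "bij_betw (from_nat_into T) (U \<alpha>) (from_nat_into T ` U \<alpha>)"
      using h by (auto simp: bij_betw_def intro: inj_on_subset)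
    moreover have "from_nat_into T ` U \<alpha> = {\<alpha>} \<times> {k. enat k < lam \<alpha>}"
    proof -
      have "from_nat_into T ` U \<alpha> = {x \<in> from_nat_into T ` UNIV. fst x = \<alpha>}"
        by (auto simp: U_def)
      also have "\<dots> = {x \<in> T. fst x = \<alpha>}" using h by (simp add: bij_betw_def)
      finally show ?thesis by (auto simp: T_def)
    qed
    ultimately have b: "bij_betw (from_nat_into T) (U \<alpha>) ({\<alpha>} \<times> {k. enat k < lam \<alpha>})" by simp
    show ?thesis
    proof (cases "lam \<alpha>")
      case (enat n)
      then have "{k. enat k < lam \<alpha>} = {..<n}" by auto
      with b show ?thesis
        using bij_betw_finite[OF b] bij_betw_same_card[OF b] enat
        by (simp add: set_size_def card_cartesian_product)
    next
      case infinity
      then show ?thesis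
        using bij_betw_finite[OF b] by (simp add: set_size_def finite_cartesian_product_iff)
    qed
  qed
  moreover from this have "U \<alpha> \<noteq> {}" for \<alpha>
    using assms by (metis infty_composition_def set_size_def finite.emptyI card.empty
        not_one_le_zero zero_enat_def)
  ultimately have "partition_of_type lam U"
    by (auto simp: partition_of_type_def disjoint_family_on_def U_def)
  then show ?thesis by blast
qed

end

theory Submission
  imports Defs
begin

text \<open>
  Write \<open>\<qq>\<close> for the radical ideal of \<open>Z\<close>, which is prime because \<open>Z\<close> is irreducible, and
  \<open>\<pi> i\<close> for the part containing \<open>i\<close>. The ideal \<open>\<QQ>\<close> is
  visible on coefficients: \<open>h \<in> \<QQ>\<close> iff every monomial of \<open>h\<close> whose exponents satisfy
  \<open>m\<^sub>i < e(\<pi> i)\<close> for all \<open>i\<close> (call it reduced) has its coefficient in \<open>\<qq>\<close>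
  (\<open>genideal_Const_Var_powers\<close>).

  Suppose that \<open>\<iota> f \<notin> \<QQ>\<close> and \<open>\<iota> g \<notin> \<QQ>\<close>, and choose reduced monomials \<open>m\<close> of \<open>\<iota> f\<close> and \<open>n\<close> of
  \<open>\<iota> g\<close> with coefficients outside \<open>\<qq>\<close>. Since \<open>e = 1\<close> on the finite parts, \<open>m\<close> and \<open>n\<close> only involve
  variables \<open>\<epsilon>\<^sub>i\<close> with \<open>i\<close> in an infinite part. A permutation \<open>\<rho>\<close> that preserves
  every part satisfies \<open>\<iota> (\<rho> g) = \<rho> (\<iota> g)\<close>, and inside the infinite parts there is room to choose
  \<open>\<rho>\<close> so that the variables from infinite parts in \<open>\<rho> (\<iota> g)\<close> are different from all those in
  \<open>\<iota> f\<close> (\<open>perm_preserving_parts_avoiding\<close>). Then the only way to write \<open>m + \<rho> n\<close> as a sum of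
  a monomial of \<open>\<iota> f\<close> and one of \<open>\<rho> (\<iota> g)\<close> is the obvious one, so the coefficient of
  \<open>m + \<rho> n\<close> in \<open>\<iota> (f \<cdot> \<rho> g)\<close> is a product of two elements outside \<open>\<qq>\<close>. As \<open>m + \<rho> n\<close> is
  again reduced, \<open>\<iota> (f \<cdot> \<rho> g) \<notin> \<QQ>\<close>. Applied to translates of elements of two \<open>\<SS>\<close>-ideals not
  contained in \<open>\<PP>\<close>, this shows that their product is not contained in \<open>\<PP>\<close>.
\<close>


section \<open>Ideals of a commutative ring type\<close>

lemma ideal_ring_of_type_algebra_iff:
  "ideal I (ring_of_type_algebra :: 'r::comm_ring_1 ring) \<longleftrightarrow>
     0 \<in> I \<and> (\<forall>a\<in>I. \<forall>b\<in>I. a + b \<in> I) \<and> (\<forall>a\<in>I. \<forall>r. r * a \<in> I)"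
proof
  assume "ideal I (ring_of_type_algebra :: 'r ring)"
  then interpret ideal I "ring_of_type_algebra :: 'r ring" .
  show "0 \<in> I \<and> (\<forall>a\<in>I. \<forall>b\<in>I. a + b \<in> I) \<and> (\<forall>a\<in>I. \<forall>r. r * a \<in> I)"
    using additive_subgroup.zero_closed[OF is_additive_subgroup]
      additive_subgroup.a_closed[OF is_additive_subgroup] I_l_closed
    by (auto simp: ring_of_type_algebra_def)
next
  assume I: "0 \<in> I \<and> (\<forall>a\<in>I. \<forall>b\<in>I. a + b \<in> I) \<and> (\<forall>a\<in>I. \<forall>r. r * a \<in> I)"
  interpret R: cring "ring_of_type_algebra :: 'r ring" by (rule cring_from_type_algebra)
  have neg: "\<ominus>\<^bsub>ring_of_type_algebra\<^esub> a = - a" for a :: 'r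
    by (rule R.minus_equality) (simp_all add: ring_of_type_algebra_def)
  show "ideal I (ring_of_type_algebra :: 'r ring)"
  proof (rule idealI)
    show "ring (ring_of_type_algebra :: 'r ring)" by (rule ring_from_type_algebra)
    show "subgroup I (add_monoid (ring_of_type_algebra :: 'r ring))"
    proof (rule R.add.subgroupI)
      fix a assume "a \<in> I"
      then have "(-1) * a \<in> I" using I by blast
      then show "\<ominus>\<^bsub>ring_of_type_algebra\<^esub> a \<in> I" by (simp add: neg)
    qed (use I in \<open>auto simp: ring_of_type_algebra_def\<close>)
  qed (use I in \<open>auto simp: ring_of_type_algebra_def mult.commute\<close>)
qed

lemma ideal_sum_closed:
  fixes I :: "'r::comm_ring_1 set"
  assumes "ideal I ring_of_type_algebra" and "\<And>x. x \<in> T \<Longrightarrow> f x \<in> I"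
  shows "sum f T \<in> I"
  using assms(2)
  by (induction T rule: infinite_finite_induct)
    (use assms(1) in \<open>auto simp: ideal_ring_of_type_algebra_iff\<close>)

lemma spec_iff:
  "\<pp> \<in> spec \<longleftrightarrow> ideal \<pp> (ring_of_type_algebra :: 'r::comm_ring_1 ring) \<and> 1 \<notin> \<pp> \<and>
     (\<forall>a b. a * b \<in> \<pp> \<longrightarrow> a \<in> \<pp> \<or> b \<in> \<pp>)"
proof
  assume "\<pp> \<in> spec"
  then have "primeideal \<pp> (ring_of_type_algebra :: 'r ring)" by (simp add: spec_def)
  then interpret primeideal \<pp> "ring_of_type_algebra :: 'r ring" .
  show "ideal \<pp> (ring_of_type_algebra :: 'r ring) \<and> 1 \<notin> \<pp> \<and>
     (\<forall>a b. a * b \<in> \<pp> \<longrightarrow> a \<in> \<pp> \<or> b \<in> \<pp>)"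
    using is_ideal one_imp_carrier I_notcarr I_prime by (auto simp: ring_of_type_algebra_def)
next
  assume "ideal \<pp> (ring_of_type_algebra :: 'r ring) \<and> 1 \<notin> \<pp> \<and>
     (\<forall>a b. a * b \<in> \<pp> \<longrightarrow> a \<in> \<pp> \<or> b \<in> \<pp>)"
  then have "primeideal \<pp> (ring_of_type_algebra :: 'r ring)"
    using cring_from_type_algebra[where 'a='r]
    by (intro primeidealI) (auto simp: ring_of_type_algebra_def)
  then show "\<pp> \<in> spec" by (simp add: spec_def)
qed

lemma radical_ideal_irreducible:
  fixes Z :: "'r::comm_ring_1 set set"
  assumes "Z \<subseteq> spec" and "irreducible_space (subtopology zariski Z)"
  shows "radical_ideal Z \<in> spec"
  unfolding spec_iff
proof (intro conjI allI impI)
  have ideals: "ideal \<pp> ring_of_type_algebra" "1 \<notin> \<pp>" if "\<pp> \<in> Z" for \<pp>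
    using that assms(1) by (auto simp: spec_iff)
  show "ideal (radical_ideal Z) (ring_of_type_algebra :: 'r ring)"
    using ideals(1) unfolding ideal_ring_of_type_algebra_iff radical_ideal_def by blast
  have top: "topspace (subtopology zariski Z) = Z"
    using assms(1) by (simp add: topspace_zariski Int_absorb1)
  then have "Z \<noteq> {}" using assms(2) by (simp add: irreducible_space_def)
  then show "1 \<notin> radical_ideal Z" using ideals(2) by (auto simp: radical_ideal_def)
  fix a b :: 'r
  assume ab: "a * b \<in> radical_ideal Z"
  let ?V = "\<lambda>c. {\<pp> \<in> Z. c \<in> \<pp>}"
  have closed: "closedin (subtopology zariski Z) (?V c)" for c
  proof -
    have "closedin zariski {\<pp> \<in> spec. {c} \<subseteq> \<pp>}" unfolding closedin_zariski by blast
    moreover have "?V c = {\<pp> \<in> spec. {c} \<subseteq> \<pp>} \<inter> Z" using assms(1) by auto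
    ultimately show ?thesis by (auto simp: closedin_subtopology)
  qed
  have "Z = ?V a \<union> ?V b"
    using ab assms(1) unfolding radical_ideal_def by (auto simp: spec_iff subset_iff)
  then have "?V a = Z \<or> ?V b = Z"
    using assms(2) closed top unfolding irreducible_space_def by metis
  then show "a \<in> radical_ideal Z \<or> b \<in> radical_ideal Z"
    unfolding radical_ideal_def by blast
qed


section \<open>Coefficients of polynomials\<close>

lemma mpoly_eq_sum_monomials:
  fixes f :: "('v, 'r::comm_ring_1) mpoly"
  shows "f = (\<Sum>m\<in>Poly_Mapping.keys f. Poly_Mapping.single m (Poly_Mapping.lookup f m))"
  by (rule poly_mapping_eqI)
    (simp add: lookup_sum lookup_single when_def sum.delta in_keys_iff)

lemma lookup_mult_keys:
  fixes f g :: "('v, 'r::comm_ring_1) mpoly"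
  shows "Poly_Mapping.lookup (f * g) k =
    (\<Sum>a\<in>Poly_Mapping.keys f. \<Sum>b\<in>Poly_Mapping.keys g.
       Poly_Mapping.lookup f a * Poly_Mapping.lookup g b when a + b = k)"
proof -
  have "f * g = (\<Sum>a\<in>Poly_Mapping.keys f. Poly_Mapping.single a (Poly_Mapping.lookup f a))
      * (\<Sum>b\<in>Poly_Mapping.keys g. Poly_Mapping.single b (Poly_Mapping.lookup g b))"
    by (simp flip: mpoly_eq_sum_monomials)
  then show ?thesis
    by (simp add: sum_product lookup_sum mult_single lookup_single)
qed

lemma lookup_mult_unique:
  fixes f g :: "('v, 'r::comm_ring_1) mpoly"
  assumes "\<And>a b. \<lbrakk>a \<in> Poly_Mapping.keys f; b \<in> Poly_Mapping.keys g; a + b = m + n\<rbrakk>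
      \<Longrightarrow> a = m \<and> b = n"
  shows "Poly_Mapping.lookup (f * g) (m + n) = Poly_Mapping.lookup f m * Poly_Mapping.lookup g n"
proof -
  have "Poly_Mapping.lookup (f * g) (m + n) =
    (\<Sum>a\<in>Poly_Mapping.keys f. \<Sum>b\<in>Poly_Mapping.keys g.
       if a = m then (if b = n then Poly_Mapping.lookup f m * Poly_Mapping.lookup g n else 0) else 0)"
    unfolding lookup_mult_keys using assms by (intro sum.cong refl) (auto simp: when_def)
  also have "\<dots> = (\<Sum>a\<in>Poly_Mapping.keys f. if a = m
      then (\<Sum>b\<in>Poly_Mapping.keys g.
        if b = n then Poly_Mapping.lookup f m * Poly_Mapping.lookup g n else 0) else 0)"
    by (intro sum.cong refl) simp
  also have "\<dots> = Poly_Mapping.lookup f m * Poly_Mapping.lookup g n"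
    by (simp add: sum.delta in_keys_iff)
  finally show ?thesis .
qed

text \<open>
  Only the variables in \<open>S\<close> have to be disjoint: since \<open>m\<close> and \<open>n\<close> involve no others,
  two monomials with product \<open>x\<^sup>m x\<^sup>n\<close> cannot involve others either.
\<close>

lemma lookup_mult_disjoint_variables:
  fixes f g :: "('v, 'r::comm_ring_1) mpoly"
  assumes "Poly_Mapping.lookup f m \<noteq> 0" and "Poly_Mapping.lookup g n \<noteq> 0"
    and "Poly_Mapping.keys m \<subseteq> S" and "Poly_Mapping.keys n \<subseteq> S"
    and f: "\<And>a. a \<in> Poly_Mapping.keys f \<Longrightarrow> Poly_Mapping.keys a \<subseteq> K"
    and g: "\<And>b. b \<in> Poly_Mapping.keys g \<Longrightarrow> Poly_Mapping.keys b \<inter> S \<inter> K = {}"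
  shows "Poly_Mapping.lookup (f * g) (m + n) = Poly_Mapping.lookup f m * Poly_Mapping.lookup g n"
proof (rule lookup_mult_unique)
  fix a b
  assume a: "a \<in> Poly_Mapping.keys f" and b: "b \<in> Poly_Mapping.keys g" and eq: "a + b = m + n"
  have eq': "Poly_Mapping.lookup a i + Poly_Mapping.lookup b i
      = Poly_Mapping.lookup m i + Poly_Mapping.lookup n i" for i
    using eq by (metis lookup_add)
  have m: "m \<in> Poly_Mapping.keys f" and n: "n \<in> Poly_Mapping.keys g"
    using assms(1,2) by (simp_all add: in_keys_iff)
  have "Poly_Mapping.lookup a i = Poly_Mapping.lookup m i" for i
  proof (cases "i \<in> S")
    case False
    then have "Poly_Mapping.lookup m i = 0" "Poly_Mapping.lookup n i = 0"
      using assms(3,4) by (auto simp: in_keys_iff)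
    with eq'[of i] show ?thesis by simp
  next
    case S: True
    show ?thesis
    proof (cases "i \<in> K")
      case True
      then have "Poly_Mapping.lookup b i = 0" "Poly_Mapping.lookup n i = 0"
        using g[OF b] g[OF n] S by (auto simp: in_keys_iff)
      with eq'[of i] show ?thesis by simp
    next
      case False
      then have "Poly_Mapping.lookup a i = 0" "Poly_Mapping.lookup m i = 0"
        using f[OF a] f[OF m] by (auto simp: in_keys_iff)
      then show ?thesis by simp
    qed
  qed
  then have "a = m" by (rule poly_mapping_eqI)
  with eq show "a = m \<and> b = n" by simp
qed

lemma Var_power: "Var i ^ k = Poly_Mapping.single (Poly_Mapping.single i k) 1"
  by (induction k) (simp_all add: Var_def mult_single flip: single_add)

text \<open>
  The coefficientwise description of the ideal generated by \<open>\<qq>\<close> and powers \<open>x\<^sub>i\<^bsup>E i\<^esup>\<close>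
  of the variables.
\<close>

lemma genideal_Const_Var_powers:
  fixes \<qq> :: "'r::comm_ring_1 set" and E :: "'v \<Rightarrow> nat"
  assumes \<qq>: "ideal \<qq> ring_of_type_algebra"
  shows "genideal ring_of_type_algebra (Const ` \<qq> \<union> {Var i ^ E i | i. True}) =
    {h. \<forall>m. (\<forall>i. Poly_Mapping.lookup m i < E i) \<longrightarrow> Poly_Mapping.lookup h m \<in> \<qq>}"
    (is "genideal ?R ?G = ?J")
proof
  interpret R: cring ?R by (rule cring_from_type_algebra)
  have G: "?G \<subseteq> carrier ?R" by (simp add: ring_of_type_algebra_def)
  have q0: "0 \<in> \<qq>" and qmult: "\<And>a r. a \<in> \<qq> \<Longrightarrow> r * a \<in> \<qq>"
    using \<qq> by (auto simp: ideal_ring_of_type_algebra_iff)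
  have "ideal ?J ?R"
    unfolding ideal_ring_of_type_algebra_iff
  proof (intro conjI ballI allI)
    show "0 \<in> ?J" using q0 by simp
  next
    fix a b assume "a \<in> ?J" "b \<in> ?J"
    then show "a + b \<in> ?J"
      using \<qq> by (auto simp: lookup_add ideal_ring_of_type_algebra_iff)
  next
    fix h r assume h: "h \<in> ?J"
    show "r * h \<in> ?J"
    proof (intro CollectI allI impI)
      fix m :: "'v \<Rightarrow>\<^sub>0 nat"
      assume m: "\<forall>i. Poly_Mapping.lookup m i < E i"
      have "(Poly_Mapping.lookup r a * Poly_Mapping.lookup h b when a + b = m) \<in> \<qq>" for a b
      proof (cases "a + b = m")
        case True
        then have "Poly_Mapping.lookup b i \<le> Poly_Mapping.lookup m i" for i
          by (auto simp: lookup_add)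
        then have "\<forall>i. Poly_Mapping.lookup b i < E i" using m le_less_trans by blast
        with h True show ?thesis by (simp add: qmult)
      qed (simp add: q0)
      then show "Poly_Mapping.lookup (r * h) m \<in> \<qq>"
        unfolding lookup_mult_keys by (intro ideal_sum_closed[OF \<qq>])
    qed
  qed
  moreover have "?G \<subseteq> ?J"
  proof
    fix h :: "('v, 'r) mpoly" assume "h \<in> ?G"
    then consider a where "a \<in> \<qq>" "h = Const a" | i where "h = Var i ^ E i" by blast
    then show "h \<in> ?J"
    proof cases
      case 1
      then show ?thesis using q0 by (auto simp: Const_def lookup_single when_def)
    next
      case 2
      then show ?thesis using q0 by (auto simp: Var_power lookup_single when_def)
    qed
  qed
  ultimately show "genideal ?R ?G \<subseteq> ?J" by (rule R.genideal_minimal)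
  have Q: "ideal (genideal ?R ?G) ?R" by (rule R.genideal_ideal[OF G])
  have sub: "?G \<subseteq> genideal ?R ?G" by (rule R.genideal_self[OF G])
  have Qmult: "r * a \<in> genideal ?R ?G" if "a \<in> genideal ?R ?G" for a r
    using Q that by (auto simp: ideal_ring_of_type_algebra_iff)
  show "?J \<subseteq> genideal ?R ?G"
  proof
    fix h assume h: "h \<in> ?J"
    have "Poly_Mapping.single m (Poly_Mapping.lookup h m) \<in> genideal ?R ?G" for m
    proof (cases "\<forall>i. Poly_Mapping.lookup m i < E i")
      case True
      then have "Const (Poly_Mapping.lookup h m) \<in> genideal ?R ?G" using h sub by blast
      from Qmult[OF this, of "Poly_Mapping.single m 1"] show ?thesis
        by (simp add: Const_def mult_single)
    next
      case False
      then obtain i where i: "E i \<le> Poly_Mapping.lookup m i" by (auto simp: not_less)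
      define n where "n = m - Poly_Mapping.single i (E i)"
      have "n + Poly_Mapping.single i (E i) = m"
        using i by (intro poly_mapping_eqI)
          (auto simp: n_def lookup_add lookup_minus lookup_single when_def)
      then have "Poly_Mapping.single m (Poly_Mapping.lookup h m)
          = Poly_Mapping.single n (Poly_Mapping.lookup h m) * Var i ^ E i"
        by (simp add: Var_power mult_single)
      moreover have "Var i ^ E i \<in> genideal ?R ?G" using sub by blast
      ultimately show ?thesis by (simp only: Qmult)
    qed
    then show "h \<in> genideal ?R ?G"
      by (subst mpoly_eq_sum_monomials) (intro ideal_sum_closed[OF Q])
  qed
qed


section \<open>The action of permutations\<close>

lemma Const_hom: "Const 1 = 1" "Const (a + b) = Const a + Const b" "Const (a * b) = Const a * Const b"
  by (simp_all add: Const_def mult_single single_add)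

lemma config_const_hom:
  "config_const 1 = 1"
  "config_const (a + b) = config_const a + config_const b"
  "config_const (a * b) = config_const a * config_const b"
  by (simp_all add: config_const_def Const_hom config_frac_simps config_frac_zero_one denoms.one)

lemma perm_act_simps:
  "perm_act \<sigma> 0 = 0" "perm_act \<sigma> 1 = 1" "perm_act \<sigma> (f + g) = perm_act \<sigma> f + perm_act \<sigma> g"
  "perm_act \<sigma> (f * g) = perm_act \<sigma> f * perm_act \<sigma> g" "perm_act \<sigma> (Const a) = Const a"
  "perm_act \<sigma> (Var i) = Var (Perm.apply \<sigma> i)"
  unfolding perm_act_def
  by (simp_all add: aeval_zero aeval_one aeval_add aeval_mult aeval_Const aeval_Var Const_hom)

lemma iota_simps:
  "iota U 0 = 0" "iota U 1 = 1" "iota U (f + g) = iota U f + iota U g"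
  "iota U (f * g) = iota U f * iota U g" "iota U (Const a) = Const (config_const a)"
  "iota U (Var i) = Const (config_coord (part_of U i)) + Var i"
  unfolding iota_def
  by (simp_all add: aeval_zero aeval_one aeval_add aeval_mult aeval_Const aeval_Var
      Const_hom config_const_hom)

lemma hom_aeval:
  fixes \<psi> :: "'s::comm_ring_1 \<Rightarrow> 't::comm_ring_1"
  assumes "\<psi> 0 = 0" "\<psi> 1 = 1" "\<And>a b. \<psi> (a + b) = \<psi> a + \<psi> b" "\<And>a b. \<psi> (a * b) = \<psi> a * \<psi> b"
  shows "\<psi> (aeval \<phi> x f) = aeval (\<lambda>a. \<psi> (\<phi> a)) (\<lambda>v. \<psi> (x v)) f"
proof -
  have sum: "\<psi> (sum h T) = (\<Sum>x\<in>T. \<psi> (h x))" for h :: "'x \<Rightarrow> 's" and T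
    by (induction T rule: infinite_finite_induct) (simp_all add: assms)
  have prod: "\<psi> (prod h T) = (\<Prod>x\<in>T. \<psi> (h x))" for h :: "'x \<Rightarrow> 's" and T
    by (induction T rule: infinite_finite_induct) (simp_all add: assms)
  have power: "\<psi> (a ^ k) = \<psi> a ^ k" for a k
    by (induction k) (simp_all add: assms)
  show ?thesis unfolding aeval_def by (simp add: sum prod power assms)
qed

lemma perm_act_perm_act: "perm_act \<sigma> (perm_act \<tau> f) = perm_act (\<sigma> * \<tau>) f"
proof -
  have "perm_act \<sigma> (perm_act \<tau> f)
      = aeval (\<lambda>a. perm_act \<sigma> (Const a)) (\<lambda>i. perm_act \<sigma> (Var (Perm.apply \<tau> i))) f"
    unfolding perm_act_def[of \<tau>] by (rule hom_aeval) (rule perm_act_simps)+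
  also have "\<dots> = perm_act (\<sigma> * \<tau>) f"
    by (simp add: perm_act_simps perm_act_def[of "\<sigma> * \<tau>"] apply_times)
  finally show ?thesis .
qed

lemma iota_perm_act:
  assumes "\<And>i. part_of U (Perm.apply \<sigma> i) = part_of U i"
  shows "iota U (perm_act \<sigma> f) = perm_act \<sigma> (iota U f)"
proof -
  have "iota U (perm_act \<sigma> f)
      = aeval (\<lambda>a. iota U (Const a)) (\<lambda>i. iota U (Var (Perm.apply \<sigma> i))) f"
    unfolding perm_act_def by (rule hom_aeval) (rule iota_simps)+
  also have "\<dots> = aeval (\<lambda>a. perm_act \<sigma> (Const (config_const a)))
      (\<lambda>i. perm_act \<sigma> (Const (config_coord (part_of U i)) + Var i)) f"
    by (simp add: iota_simps perm_act_simps assms)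
  also have "\<dots> = perm_act \<sigma> (iota U f)"
    unfolding iota_def by (rule hom_aeval[symmetric]) (rule perm_act_simps)+
  finally show ?thesis .
qed

text \<open>The exponent vector \<open>m\<close> with the variable \<open>i\<close> renamed to \<open>\<sigma> i\<close>.\<close>

definition rename_exponents :: "nat perm \<Rightarrow> (nat \<Rightarrow>\<^sub>0 nat) \<Rightarrow> (nat \<Rightarrow>\<^sub>0 nat)" where
  "rename_exponents \<sigma> m =
     (\<Sum>i\<in>Poly_Mapping.keys m. Poly_Mapping.single (Perm.apply \<sigma> i) (Poly_Mapping.lookup m i))"

lemma lookup_rename_exponents:
  "Poly_Mapping.lookup (rename_exponents \<sigma> m) (Perm.apply \<sigma> i) = Poly_Mapping.lookup m i"
  by (simp add: rename_exponents_def lookup_sum lookup_single apply_inj when_def sum.delta in_keys_iff)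

lemma apply_surj: "\<exists>j. i = Perm.apply \<sigma> j"
  using bij_is_surj[OF bij_apply[of \<sigma>]] by (rule surjD)

lemma keys_rename_exponents:
  "Poly_Mapping.keys (rename_exponents \<sigma> m) = Perm.apply \<sigma> ` Poly_Mapping.keys m"
proof (intro Set.set_eqI)
  fix i
  obtain j where "i = Perm.apply \<sigma> j" using apply_surj[of i \<sigma>] ..
  then show "i \<in> Poly_Mapping.keys (rename_exponents \<sigma> m)
      \<longleftrightarrow> i \<in> Perm.apply \<sigma> ` Poly_Mapping.keys m"
    by (simp only: inj_image_mem_iff[OF bij_is_inj[OF bij_apply]] in_keys_iff
        lookup_rename_exponents)
qed

lemma rename_exponents_inj: "rename_exponents \<sigma> m = rename_exponents \<sigma> n \<longleftrightarrow> m = n"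
  using lookup_rename_exponents[of \<sigma> m] lookup_rename_exponents[of \<sigma> n]
  by (auto intro: poly_mapping_eqI)

lemma perm_act_single:
  "perm_act \<sigma> (Poly_Mapping.single m c) = Poly_Mapping.single (rename_exponents \<sigma> m) c"
proof -
  have "(\<Prod>i\<in>T. Poly_Mapping.single (h i) (1 :: 'a)) = Poly_Mapping.single (sum h T) 1"
    for T and h :: "nat \<Rightarrow> (nat \<Rightarrow>\<^sub>0 nat)"
    by (induction T rule: infinite_finite_induct) (simp_all add: mult_single)
  then show ?thesis
    unfolding perm_act_def aeval_single[OF Const_hom] Var_power
    by (simp add: Const_def mult_single rename_exponents_def)
qed

lemma perm_act_eq_sum:
  "perm_act \<sigma> h = (\<Sum>m\<in>Poly_Mapping.keys h.
     Poly_Mapping.single (rename_exponents \<sigma> m) (Poly_Mapping.lookup h m))"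
proof -
  have "perm_act \<sigma> (sum f T) = (\<Sum>x\<in>T. perm_act \<sigma> (f x))"
    for f :: "'x \<Rightarrow> (nat, 'a) mpoly" and T
    by (induction T rule: infinite_finite_induct) (simp_all add: perm_act_simps)
  from this[of "\<lambda>m. Poly_Mapping.single m (Poly_Mapping.lookup h m)" "Poly_Mapping.keys h"]
  show ?thesis by (simp add: perm_act_single flip: mpoly_eq_sum_monomials)
qed

lemma lookup_perm_act:
  "Poly_Mapping.lookup (perm_act \<sigma> h) (rename_exponents \<sigma> m) = Poly_Mapping.lookup h m"
  by (simp add: perm_act_eq_sum lookup_sum lookup_single rename_exponents_inj when_def
      sum.delta in_keys_iff)

lemma keys_perm_act:
  "Poly_Mapping.keys (perm_act \<sigma> h) \<subseteq> rename_exponents \<sigma> ` Poly_Mapping.keys h"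
  unfolding perm_act_eq_sum by (rule order_trans[OF keys_sum]) auto

text \<open>The fibres of \<open>p\<close> are the parts that \<open>\<sigma>\<close> preserves.\<close>

lemma perm_preserving_parts_avoiding:
  assumes "finite B" and "finite K" and "\<And>b. b \<in> B \<Longrightarrow> infinite {i. p i = p b}"
  shows "\<exists>\<sigma> :: 'x perm. (\<forall>i. p (Perm.apply \<sigma> i) = p i) \<and> Perm.apply \<sigma> ` B \<inter> K = {}"
  using assms(1,3)
proof (induction B)
  case empty
  show ?case by (rule exI[of _ 1]) simp
next
  case (insert b B)
  then obtain \<sigma> where \<sigma>: "\<And>i. p (Perm.apply \<sigma> i) = p i" "Perm.apply \<sigma> ` B \<inter> K = {}" by auto
  have "infinite {i. p i = p b}" using insert.prems by blast
  moreover have "finite (K \<union> Perm.apply \<sigma> ` B)" using assms(2) insert.hyps by simp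
  ultimately have "\<not> {i. p i = p b} \<subseteq> K \<union> Perm.apply \<sigma> ` B" by (meson finite_subset)
  then obtain c where c: "p c = p b" "c \<notin> K" "c \<notin> Perm.apply \<sigma> ` B" by blast
  \<comment> \<open>Neither \<open>\<sigma> b\<close> nor \<open>c\<close> lies in the image of \<open>B\<close>, so the transposition leaves that image fixed.\<close>
  define \<tau> where "\<tau> = Perm.swap (Perm.apply \<sigma> b) c * \<sigma>"
  have \<tau>: "Perm.apply \<tau> i = (if i = b then c else if Perm.apply \<sigma> i = c then Perm.apply \<sigma> b
      else Perm.apply \<sigma> i)" for i
    by (auto simp: \<tau>_def apply_times apply_inj apply_swap_eq_iff)
  have "p (Perm.apply \<tau> i) = p i" for i
    using \<sigma>(1) c(1) by (metis \<tau>)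
  moreover have "Perm.apply \<tau> i \<notin> K" if "i \<in> insert b B" for i
    using that \<sigma>(2) c insert.hyps by (auto simp: \<tau>)
  ultimately show ?case by blast
qed


section \<open>Primality\<close>

lemma part_of_eqI:
  assumes "partition_of_type lam U" and "i \<in> U \<alpha>"
  shows "part_of U i = \<alpha>"
  unfolding part_of_def
  using assms by (intro the_equality) (auto simp: partition_of_type_def disjoint_family_on_def)

lemma part_eq_Collect_part_of:
  assumes "partition_of_type lam U"
  shows "U \<alpha> = {i. part_of U i = \<alpha>}"
proof -
  have "\<exists>\<alpha>. i \<in> U \<alpha>" for i using assms by (auto simp: partition_of_type_def)
  then show ?thesis using part_of_eqI[OF assms] by blast
qed

text \<open>
  Moving the variables of \<open>g\<close> that lie in infinite parts away from those of \<open>f\<close> makes the product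
  survive modulo \<open>\<QQ>\<close>.
\<close>

lemma exists_perm_product_not_in_frakQ:
  fixes Z :: "('i::finite, 'a::comm_ring_1) config_ring set set"
  assumes U: "partition_of_type lam U" and "reduced_weighting lam e"
    and prime: "radical_ideal Z \<in> spec"
    and f: "iota U f \<notin> frakQ U e Z" and g: "iota U g \<notin> frakQ U e Z"
  shows "\<exists>\<sigma>. iota U (f * perm_act \<sigma> g) \<notin> frakQ U e Z"
proof -
  let ?q = "radical_ideal Z" and ?E = "\<lambda>i. e (part_of U i)"
  have q: "ideal ?q ring_of_type_algebra" using prime by (simp add: spec_iff)
  have q0: "0 \<in> ?q" using q by (simp add: ideal_ring_of_type_algebra_iff)
  have Q: "h \<in> frakQ U e Z \<longleftrightarrow>
      (\<forall>m. (\<forall>i. Poly_Mapping.lookup m i < ?E i) \<longrightarrow> Poly_Mapping.lookup h m \<in> ?q)" for h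
    unfolding frakQ_def genideal_Const_Var_powers[OF q] by simp
  obtain m where m: "\<And>i. Poly_Mapping.lookup m i < ?E i" "Poly_Mapping.lookup (iota U f) m \<notin> ?q"
    using f Q by blast
  obtain n where n: "\<And>i. Poly_Mapping.lookup n i < ?E i" "Poly_Mapping.lookup (iota U g) n \<notin> ?q"
    using g Q by blast
  define S where "S = {i. infinite (U (part_of U i))}"
  \<comment> \<open>On a finite part the weight is \<open>1\<close>, so reduced exponents vanish there.\<close>
  have E1: "?E i = 1" if "i \<notin> S" for i
    using that U assms(2)
    by (auto simp: S_def reduced_weighting_def partition_of_type_def set_size_def
        dest!: spec[of _ "part_of U i"] split: if_splits)
  have keysS: "Poly_Mapping.keys k \<subseteq> S" if "\<And>i. Poly_Mapping.lookup k i < ?E i" for k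
    using that E1 by (metis in_keys_iff less_one subsetI)
  define K where "K = (\<Union>a\<in>Poly_Mapping.keys (iota U f). Poly_Mapping.keys a)"
  define B where "B = (\<Union>b\<in>Poly_Mapping.keys (iota U g). Poly_Mapping.keys b) \<inter> S"
  have "finite K" "finite B" by (simp_all add: K_def B_def)
  moreover have "infinite {i. part_of U i = part_of U b}" if "b \<in> B" for b
    using that part_eq_Collect_part_of[OF U] by (simp add: B_def S_def)
  ultimately obtain \<sigma> where \<sigma>: "\<And>i. part_of U (Perm.apply \<sigma> i) = part_of U i"
      "Perm.apply \<sigma> ` B \<inter> K = {}"
    using perm_preserving_parts_avoiding[of B K "part_of U"] by blast
  let ?n = "rename_exponents \<sigma> n"
  have n': "Poly_Mapping.lookup ?n i < ?E i" for i
  proof -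
    obtain j where "i = Perm.apply \<sigma> j" using apply_surj[of i \<sigma>] ..
    then show ?thesis using n(1)[of j] by (simp add: lookup_rename_exponents \<sigma>(1))
  qed
  have gn: "Poly_Mapping.lookup (perm_act \<sigma> (iota U g)) ?n \<notin> ?q"
    using n(2) by (simp add: lookup_perm_act)
  have keysf: "Poly_Mapping.keys a \<subseteq> K" if "a \<in> Poly_Mapping.keys (iota U f)" for a
    using that by (auto simp: K_def)
  have keysg: "Poly_Mapping.keys b \<inter> S \<inter> K = {}"
    if b: "b \<in> Poly_Mapping.keys (perm_act \<sigma> (iota U g))" for b
  proof -
    obtain b' where b': "b' \<in> Poly_Mapping.keys (iota U g)" "b = rename_exponents \<sigma> b'"
      using b keys_perm_act[of \<sigma> "iota U g"] by blast
    have "Poly_Mapping.keys b \<inter> S \<subseteq> Perm.apply \<sigma> ` B"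
      using b' by (auto simp: keys_rename_exponents B_def S_def \<sigma>(1))
    with \<sigma>(2) show ?thesis by blast
  qed
  have nz: "Poly_Mapping.lookup (iota U f) m \<noteq> 0"
      "Poly_Mapping.lookup (perm_act \<sigma> (iota U g)) ?n \<noteq> 0"
    using m(2) gn q0 by auto
  have "Poly_Mapping.lookup (iota U (f * perm_act \<sigma> g)) (m + ?n)
      = Poly_Mapping.lookup (iota U f) m * Poly_Mapping.lookup (perm_act \<sigma> (iota U g)) ?n"
    unfolding iota_simps iota_perm_act[OF \<sigma>(1)]
    by (rule lookup_mult_disjoint_variables[OF nz keysS[OF m(1)] keysS[OF n'] keysf keysg])
  then have "Poly_Mapping.lookup (iota U (f * perm_act \<sigma> g)) (m + ?n) \<notin> ?q"
    using m(2) gn prime by (auto simp: spec_iff)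
  moreover have "Poly_Mapping.lookup (m + ?n) i < ?E i" for i
  proof (cases "i \<in> K")
    case True
    have "?n \<in> Poly_Mapping.keys (perm_act \<sigma> (iota U g))" using nz(2) by (simp add: in_keys_iff)
    from keysg[OF this] keysS[OF n'] True have "i \<notin> Poly_Mapping.keys ?n" by blast
    then show ?thesis using m(1) by (simp add: lookup_add in_keys_iff)
  next
    case False
    have "m \<in> Poly_Mapping.keys (iota U f)" using nz(1) by (simp add: in_keys_iff)
    from keysf[OF this] False have "Poly_Mapping.lookup m i = 0" by (auto simp: in_keys_iff)
    then show ?thesis using n' by (simp add: lookup_add)
  qed
  ultimately show ?thesis using Q by blast
qed

lemma ideal_frakQ: "ideal (frakQ U e Z) ring_of_type_algebra"
proof -
  interpret R: cring "ring_of_type_algebra :: (nat, ('a, 'b) config_ring) mpoly ring"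
    by (rule cring_from_type_algebra)
  show ?thesis
    unfolding frakQ_def by (rule R.genideal_ideal) (simp add: ring_of_type_algebra_def)
qed

lemma sym_ideal_frakP: "sym_ideal (frakP U e Z)"
  unfolding sym_ideal_def
proof (intro conjI allI)
  show "ideal (frakP U e Z) ring_of_type_algebra"
    using ideal_frakQ[of U e Z]
    by (auto simp: ideal_ring_of_type_algebra_iff frakP_def perm_act_simps iota_simps)
  show "perm_act \<sigma> ` frakP U e Z \<subseteq> frakP U e Z" for \<sigma>
    by (auto simp: frakP_def perm_act_perm_act)
qed

theorem proposition3p16:
  fixes lam :: "'i::finite \<Rightarrow> enat"
    and e :: "'i \<Rightarrow> nat"
    and Z :: "('i, 'a::comm_ring_1) config_ring set set"
    and U :: "'i \<Rightarrow> nat set"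
  assumes "infty_composition lam"
    and "weighting e"
    and "partition_of_type lam U"
    and "Z \<subseteq> spec"
    and "reduced_weighting lam e"
    and "irreducible_space (subtopology zariski Z)"
  shows "sym_prime (frakP U e Z)"
proof -
  have prime: "radical_ideal Z \<in> spec"
    by (rule radical_ideal_irreducible) (use assms in auto)
  then have q: "ideal (radical_ideal Z) ring_of_type_algebra" and one: "1 \<notin> radical_ideal Z"
    by (simp_all add: spec_iff)
  \<comment> \<open>All weights are positive, so the monomial \<open>1\<close> is reduced.\<close>
  have "1 \<notin> frakQ U e Z"
    unfolding frakQ_def genideal_Const_Var_powers[OF q]
    using one assms(2) by (auto simp: weighting_def Suc_le_eq intro!: exI[of _ 0])
  then have "1 \<notin> frakP U e Z" by (simp add: frakP_def perm_act_simps iota_simps)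
  moreover have "\<aa> \<subseteq> frakP U e Z \<or> \<bb> \<subseteq> frakP U e Z"
    if \<aa>: "sym_ideal \<aa>" and \<bb>: "sym_ideal \<bb>"
      and prod: "ideal_prod ring_of_type_algebra \<aa> \<bb> \<subseteq> frakP U e Z" for \<aa> \<bb>
  proof (rule ccontr)
    assume "\<not> ?thesis"
    then obtain f \<sigma> g \<tau> where f: "f \<in> \<aa>" "iota U (perm_act \<sigma> f) \<notin> frakQ U e Z"
      and g: "g \<in> \<bb>" "iota U (perm_act \<tau> g) \<notin> frakQ U e Z"
      by (auto simp: frakP_def)
    obtain \<rho> where \<rho>: "iota U (perm_act \<sigma> f * perm_act \<rho> (perm_act \<tau> g)) \<notin> frakQ U e Z"
      using exists_perm_product_not_in_frakQ[OF assms(3,5) prime f(2) g(2)] by blast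
    \<comment> \<open>Chosen so that \<open>\<sigma> (f \<cdot> g') = \<sigma> f \<cdot> \<rho> (\<tau> g)\<close>.\<close>
    define g' where "g' = perm_act (inverse \<sigma> * \<rho> * \<tau>) g"
    have "g' \<in> \<bb>" using g(1) \<bb> by (auto simp: g'_def sym_ideal_def)
    then have "f * g' \<in> frakP U e Z"
      using ideal_prod.prod[OF f(1), of g' \<bb> ring_of_type_algebra] prod
      by (auto simp: ring_of_type_algebra_def)
    then have "iota U (perm_act \<sigma> (f * g')) \<in> frakQ U e Z" by (simp add: frakP_def)
    moreover have "\<sigma> * (inverse \<sigma> * \<rho> * \<tau>) = \<rho> * \<tau>"
      by (simp add: mult.assoc[symmetric])
    ultimately show False
      using \<rho> by (simp add: g'_def perm_act_simps perm_act_perm_act)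
  qed
  ultimately show ?thesis
    using sym_ideal_frakP unfolding sym_prime_def by blast
qed

end
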